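(* Let $R$ be a commutative ring with identity such that for each maximal ideal $\mathcal{M}$, $\mathcal{M}^i\neq\mathcal{M}^{i+1}$ for all $i\ge 0$ and $\bigcap_{i\geq0}\mathcal{M}^i=(0)$. Let $\mathcal{F}$ be a finite set of maximal ideals and $\mathit{M}(\mathcal{F})$ the monoid generated by $\mathcal{F}$. For every $\mathcal{I}\in\mathit{M}(\mathcal{F})$ let $a_{\mathcal{I}}\in\mathcal{S}_{\mathcal{I}}$. If $\mathcal{I}_1,\dots,\mathcal{I}_r\in\mathit{M}(\mathcal{F})$ are pairwise comaximal, then $$\prod_{i=1}^r a_{\mathcal{I}_i}\in\mathcal{S}_{\prod_{i=1}^r\mathcal{I}_i}.$$
   Context: $\mathit{M}(\mathcal{F})$ is the set of finite products of ideals in $\mathcal{F}$ ($R$ being the empty product), $\mathit{M}(\mathcal{F})^*=\mathit{M}(\mathcal{F})\setminus\{R\}$, and for $\mathcal{I}\in\mathit{M}(\mathcal{F})$, $\mathcal{S}_{\mathcal{I}}=\mathcal{I}\setminus\bigcup_{\mathcal{J}\in\mathit{M}(\mathcal{F})^*}\mathcal{I}\mathcal{J}$ (which is nonempty under the stated hypotheses). *)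

theory Defs
  imports "HOL-Algebra.Ideal_Product"
begin

text \<open>
  Products and powers of ideals are taken in the library's commutative monoid
  \<^term>\<open>ideals_set R\<close>, whose unit is \<^term>\<open>carrier R\<close>; thus the zeroth power
  of an ideal and the empty product of ideals are both the whole ring.
\<close>

text \<open>The factors \<open>J 1, \<dots>, J n\<close> need not be distinct, and \<open>n = 0\<close> is allowed.\<close>

definition ideal_monoid :: "('a, 'b) ring_scheme \<Rightarrow> 'a set set \<Rightarrow> 'a set set"
  where "ideal_monoid R F =
    {\<Otimes>\<^bsub>ideals_set R\<^esub> k\<in>{1..n}. J k | (n::nat) J. J \<in> {1..n} \<rightarrow> F}"

definition ideal_monoid_star :: "('a, 'b) ring_scheme \<Rightarrow> 'a set set \<Rightarrow> 'a set set"
  where "ideal_monoid_star R F = ideal_monoid R F - {carrier R}"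

definition ideal_S :: "('a, 'b) ring_scheme \<Rightarrow> 'a set set \<Rightarrow> 'a set \<Rightarrow> 'a set"
  where "ideal_S R F I = I - (\<Union>J\<in>ideal_monoid_star R F. I \<cdot>\<^bsub>R\<^esub> J)"

definition comaximal :: "('a, 'b) ring_scheme \<Rightarrow> 'a set \<Rightarrow> 'a set \<Rightarrow> bool"
  where "comaximal R I J \<longleftrightarrow> I <+>\<^bsub>R\<^esub> J = carrier R"

end

(*
  A nontrivial element of M(F) lies in some M in F, so it suffices to show that the
  product x of the a_i lies in no (I_1 ... I_r) M. Otherwise x lies in M, hence some
  a_i does. For j different from i, I_j is comaximal with M unless contained in it;
  comaximality of the I_j rules out containment once I_i is contained in M, and a_j in
  I_j and M together would give a_j in I_j M. So the cofactor y of a_i in x is a unit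
  modulo M, and a_i y in I_i M forces a_i in I_i M, a contradiction.
*)

theory Submission
  imports Defs
begin

text \<open>The sum is an ideal above the maximal ideal \<open>I\<close>, hence \<open>I\<close> or
  the whole ring; it cannot be \<open>I\<close>, because it also contains \<open>J\<close>.\<close>

lemma (in maximalideal) add_eq_carrier:
  assumes "ideal J R" "\<not> J \<subseteq> I"
  shows "J <+> I = carrier R"
proof -
  have zero: "\<zero> \<in> I" "\<zero> \<in> J"
    using additive_subgroup.zero_closed ideal.axioms(1) is_ideal assms(1) by blast+
  have J: "J \<subseteq> J <+> I"
  proof
    fix x assume x: "x \<in> J"
    then have "x \<oplus> \<zero> \<in> J <+> I"
      unfolding set_add_def' using zero by blast
    then show "x \<in> J <+> I"
      using ideal.Icarr[OF assms(1) x] by simp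
  qed
  have I: "I \<subseteq> J <+> I"
  proof
    fix x assume x: "x \<in> I"
    then have "\<zero> \<oplus> x \<in> J <+> I"
      unfolding set_add_def' using zero by blast
    then show "x \<in> J <+> I"
      using Icarr[OF x] by simp
  qed
  have id: "ideal (J <+> I) R"
    using assms(1) is_ideal by (rule add_ideals)
  have "J <+> I \<subseteq> carrier R"
    using ideal.Icarr[OF id] by blast
  then show ?thesis
    using I_maximal[OF id I] J assms(2) by blast
qed

text \<open>Primality extends from two factors to finitely many by induction. The empty product
  \<open>\<one>\<close> is excluded because a prime ideal is proper.\<close>

lemma (in primeideal) finprod_memE:
  assumes "finite A" "f \<in> A \<rightarrow> carrier R" "finprod R f A \<in> I"
  obtains i where "i \<in> A" "f i \<in> I"
proof -
  have "\<exists>i\<in>A. f i \<in> I"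
    using assms
  proof (induction A rule: finite_induct)
    case empty
    then show ?case using one_imp_carrier I_notcarr by auto
  next
    case (insert i A)
    then have "f i \<otimes> finprod R f A \<in> I" by simp
    then have "f i \<in> I \<or> finprod R f A \<in> I"
      using insert.prems by (intro I_prime) auto
    with insert show ?case by auto
  qed
  then show thesis using that by blast
qed

lemma ideal_prod_mono:
  assumes "I \<subseteq> I'" "J \<subseteq> J'"
  shows "I \<cdot>\<^bsub>R\<^esub> J \<subseteq> I' \<cdot>\<^bsub>R\<^esub> J'"
proof
  fix x assume "x \<in> I \<cdot>\<^bsub>R\<^esub> J"
  then show "x \<in> I' \<cdot>\<^bsub>R\<^esub> J'"
    by induction (use assms in \<open>auto intro: ideal_prod.intros\<close>)
qed

context cring
begin

text \<open>This makes the general facts about finite products available for products of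
  ideals.\<close>

interpretation ideals: comm_monoid "ideals_set R"
  by (rule ideals_set_is_comm_monoid)

lemma ideals_finprod_ideal:
  assumes "\<And>i. i \<in> A \<Longrightarrow> ideal (I i) R"
  shows "ideal (finprod (ideals_set R) I A) R"
proof -
  have "finprod (ideals_set R) I A \<in> carrier (ideals_set R)"
    using assms by (intro ideals.finprod_closed) (auto simp: ideals_set_def)
  then show ?thesis by (simp add: ideals_set_def)
qed

lemma ideals_set_one: "\<one>\<^bsub>ideals_set R\<^esub> = carrier R"
  by (simp add: ideals_set_def)

lemma ideals_finprod_insert:
  assumes "finite A" "i \<notin> A" "\<And>j. j \<in> insert i A \<Longrightarrow> ideal (I j) R"
  shows "finprod (ideals_set R) I (insert i A) = I i \<cdot> finprod (ideals_set R) I A"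
proof -
  have "finprod (ideals_set R) I (insert i A) = I i \<otimes>\<^bsub>ideals_set R\<^esub> finprod (ideals_set R) I A"
    using assms by (intro ideals.finprod_insert) (auto simp: ideals_set_def)
  then show ?thesis by (simp add: ideals_set_def)
qed

text \<open>Once the factor \<open>I i\<close> is split off, this is the inclusion of a product of
  two ideals in their intersection.\<close>

lemma ideals_finprod_subset:
  assumes "finite A" "i \<in> A" "\<And>j. j \<in> A \<Longrightarrow> ideal (I j) R"
  shows "finprod (ideals_set R) I A \<subseteq> I i"
proof -
  have "finprod (ideals_set R) I (insert i (A - {i})) = I i \<cdot> finprod (ideals_set R) I (A - {i})"
    using assms by (intro ideals_finprod_insert) auto
  also have "\<dots> \<subseteq> I i"
    using ideal_prod_inter[OF assms(3)[OF assms(2)], of "finprod (ideals_set R) I (A - {i})"]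
      assms(3) ideals_finprod_ideal[of "A - {i}" I] by simp
  finally show ?thesis using assms(2) by (simp add: insert_absorb)
qed

lemma finprod_mem_ideals_finprod:
  assumes "finite A" "\<And>i. i \<in> A \<Longrightarrow> ideal (I i) R" "\<And>i. i \<in> A \<Longrightarrow> f i \<in> I i"
  shows "finprod R f A \<in> finprod (ideals_set R) I A"
  using assms
proof (induction A rule: finite_induct)
  case empty
  then show ?case by (simp add: ideals_set_one)
next
  case (insert i A)
  then have "f \<in> A \<rightarrow> carrier R" "f i \<in> carrier R"
    by (auto intro: ideal.Icarr)
  with insert have "finprod R f (insert i A) = f i \<otimes> finprod R f A" by simp
  moreover have "finprod R f A \<in> finprod (ideals_set R) I A"
    using insert by simp
  moreover have "finprod (ideals_set R) I (insert i A) = I i \<cdot> finprod (ideals_set R) I A"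
    using insert by (intro ideals_finprod_insert) auto
  ultimately show ?case
    using insert.prems(2)[of i] by (simp add: ideal_prod.prod)
qed

lemma ideal_monoid_ideal:
  assumes "\<And>M. M \<in> F \<Longrightarrow> ideal M R" "K \<in> ideal_monoid R F"
  shows "ideal K R"
  using assms unfolding ideal_monoid_def by (auto intro!: ideals_finprod_ideal)

text \<open>\<open>M\<close> is a product with a single factor, and it is proper. Hence
  \<open>J = M\<close> is one of the indices of the union removed in \<open>ideal_S\<close>.\<close>

lemma maximalideal_in_ideal_monoid_star:
  assumes "maximalideal M R" "M \<in> F"
  shows "M \<in> ideal_monoid_star R F"
proof -
  have "M = (\<Otimes>\<^bsub>ideals_set R\<^esub> k\<in>{1..1::nat}. M)"
    using ideals_finprod_insert[of "{}" "1::nat" "\<lambda>_. M"] maximalideal.axioms(1)[OF assms(1)]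
    by (simp add: ideal_prod_one ideals_set_one)
  then have "M \<in> ideal_monoid R F"
    unfolding ideal_monoid_def using assms(2) by blast
  then show ?thesis
    using maximalideal.I_notcarr[OF assms(1)] unfolding ideal_monoid_star_def by auto
qed

lemma ideal_monoid_star_subsetE:
  assumes "\<And>M. M \<in> F \<Longrightarrow> ideal M R" "K \<in> ideal_monoid_star R F"
  obtains M where "M \<in> F" "K \<subseteq> M"
proof -
  obtain n :: nat and J where J: "J \<in> {1..n} \<rightarrow> F"
    and K: "K = (\<Otimes>\<^bsub>ideals_set R\<^esub> k\<in>{1..n}. J k)" and "K \<noteq> carrier R"
    using assms(2) unfolding ideal_monoid_star_def ideal_monoid_def by blast
  \<comment> \<open>The empty product is \<open>carrier R\<close>, which
    \<open>ideal_monoid_star\<close> excludes, so a factor \<open>J 1\<close> exists.\<close>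
  then have "n \<noteq> 0"
    by (auto simp: ideals_set_one)
  then have n: "1 \<in> {1..n}" by simp
  then have "K \<subseteq> J 1"
    unfolding K using assms(1) funcset_mem[OF J] by (intro ideals_finprod_subset) auto
  moreover have "J 1 \<in> F"
    using J n by blast
  ultimately show thesis using that by blast
qed

lemma ideal_S_maximalideal:
  assumes "maximalideal M R" "M \<in> F" "x \<in> ideal_S R F K"
  shows "x \<in> K" "x \<notin> K \<cdot> M"
  using assms maximalideal_in_ideal_monoid_star[OF assms(1,2)] unfolding ideal_S_def by auto

text \<open>Otherwise \<open>K\<close> and \<open>M\<close> are comaximal, so
  \<open>K \<cdot> M\<close> equals \<open>K \<inter> M\<close> and contains \<open>x\<close>, which
  membership in \<open>ideal_S\<close> forbids.\<close>

lemma ideal_S_mem_maximalideal: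
  assumes "maximalideal M R" "M \<in> F" "ideal K R" "x \<in> ideal_S R F K" "x \<in> M"
  shows "K \<subseteq> M"
proof (rule ccontr)
  assume "\<not> K \<subseteq> M"
  then have "K \<cdot> M = K \<inter> M"
    using assms(3) maximalideal.axioms(1)[OF assms(1)]
      maximalideal.add_eq_carrier[OF assms(1,3)] by (intro ideal_prod_eq_inter)
  then show False
    using ideal_S_maximalideal[OF assms(1,2,4)] assms(5) by simp
qed

text \<open>Since \<open>y\<close> is invertible modulo \<open>M\<close>, there are \<open>z\<close>
  and \<open>m \<in> M\<close> with \<open>\<one> = z \<otimes> y \<oplus> m\<close>. Multiplying by
  \<open>x\<close> writes \<open>x\<close> as a sum of two elements of
  \<open>K \<cdot> M\<close>.\<close>

lemma mem_ideal_prod_maximalideal_cancel: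
  assumes "maximalideal M R" "ideal K R" "x \<in> K" "y \<in> carrier R" "y \<notin> M" "x \<otimes> y \<in> K \<cdot> M"
  shows "x \<in> K \<cdot> M"
proof -
  interpret M: maximalideal M R by fact
  have x: "x \<in> carrier R"
    using assms(2,3) by (rule ideal.Icarr)
  have "\<one> \<in> PIdl y <+> M"
    using M.add_eq_carrier[OF cgenideal_ideal[OF assms(4)]] cgenideal_self[OF assms(4)] assms(5)
    by blast
  then obtain z m where z: "z \<in> carrier R" and m: "m \<in> M" and one: "\<one> = z \<otimes> y \<oplus> m"
    unfolding set_add_def' cgenideal_def by auto
  have KM: "ideal (K \<cdot> M) R"
    using assms(2) M.is_ideal by (rule ideal_prod_is_ideal)
  \<comment> \<open>The first summand is a multiple of \<open>x \<otimes> y\<close>; the second is a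
    product of an element of \<open>K\<close> and one of \<open>M\<close>.\<close>
  have "x \<otimes> y \<otimes> z \<oplus> x \<otimes> m \<in> K \<cdot> M"
    using ideal_prod.sum[OF ideal.I_r_closed[OF KM assms(6) z] ideal_prod.prod[OF assms(3) m]] .
  moreover have "x \<otimes> y \<otimes> z \<oplus> x \<otimes> m = x \<otimes> (z \<otimes> y \<oplus> m)"
    using x z assms(4) M.Icarr[OF m] by algebra
  ultimately show ?thesis
    unfolding one[symmetric] using x by simp
qed

end

theorem mainTheorem9:
  fixes R :: "('a, 'b) ring_scheme" (structure)
    and F :: "'a set set" and a :: "'a set \<Rightarrow> 'a"
    and r :: nat and I :: "nat \<Rightarrow> 'a set"
  assumes "cring R"
    and "\<And>M i. maximalideal M R \<Longrightarrow>
           M [^]\<^bsub>ideals_set R\<^esub> (i::nat) \<noteq> M [^]\<^bsub>ideals_set R\<^esub> (i + 1)"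
    and "\<And>M. maximalideal M R \<Longrightarrow> (\<Inter>i::nat. M [^]\<^bsub>ideals_set R\<^esub> i) = {\<zero>}"
    and "finite F"
    and "\<And>M. M \<in> F \<Longrightarrow> maximalideal M R"
    and "\<And>K. K \<in> ideal_monoid R F \<Longrightarrow> a K \<in> ideal_S R F K"
    and "\<And>i. i \<in> {1..r} \<Longrightarrow> I i \<in> ideal_monoid R F"
    and "\<And>i j. i \<in> {1..r} \<Longrightarrow> j \<in> {1..r} \<Longrightarrow> i \<noteq> j \<Longrightarrow> comaximal R (I i) (I j)"
  shows "(\<Otimes>i\<in>{1..r}. a (I i)) \<in> ideal_S R F (\<Otimes>\<^bsub>ideals_set R\<^esub> i\<in>{1..r}. I i)"
proof -
  interpret cring R by fact
  let ?P = "\<Otimes>\<^bsub>ideals_set R\<^esub> i\<in>{1..r}. I i"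
  let ?x = "\<Otimes>i\<in>{1..r}. a (I i)"
  have idF: "ideal M R" if "M \<in> F" for M
    using assms(5)[OF that] by (rule maximalideal.axioms(1))
  have idI: "ideal (I i) R" if "i \<in> {1..r}" for i
    using idF assms(7)[OF that] by (rule ideal_monoid_ideal)
  have aS: "a (I i) \<in> ideal_S R F (I i)" if "i \<in> {1..r}" for i
    using assms(6,7) that by blast
  have aI: "a (I i) \<in> I i" if "i \<in> {1..r}" for i
    using aS[OF that] unfolding ideal_S_def by blast
  have ac: "a (I i) \<in> carrier R" if "i \<in> {1..r}" for i
    using idI[OF that] aI[OF that] by (rule ideal.Icarr)
  have idP: "ideal ?P R"
    using idI by (rule ideals_finprod_ideal)
  have False if J: "J \<in> ideal_monoid_star R F" and xJ: "?x \<in> ?P \<cdot> J" for J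
  proof -
    obtain M where M: "M \<in> F" "J \<subseteq> M"
      using ideal_monoid_star_subsetE[OF idF J] by blast
    interpret M: maximalideal M R using assms(5) M(1) by blast
    interpret M: primeideal M R
      using M.is_maximalideal by (rule maximalideal_prime)
    \<comment> \<open>Enlarging \<open>J\<close> to \<open>M\<close> reduces the removed union to
      its members given by maximal ideals in \<open>F\<close>.\<close>
    have xM: "?x \<in> ?P \<cdot> M"
      using xJ ideal_prod_mono[OF order_refl M(2)] by blast
    then have "?x \<in> M"
      using ideal_prod_inter[OF idP M.is_ideal] by blast
    then obtain i where i: "i \<in> {1..r}" and aM: "a (I i) \<in> M"
      using M.finprod_memE[of "{1..r}" "\<lambda>i. a (I i)"] ac by blast
    have sub: "I i \<subseteq> M"
      using M.is_maximalideal M(1) idI[OF i] aS[OF i] aM by (rule ideal_S_mem_maximalideal)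
    define y where "y = (\<Otimes>j\<in>{1..r} - {i}. a (I j))"
    have yc: "y \<in> carrier R"
      unfolding y_def using ac by (intro finprod_closed) auto
    have "y \<notin> M"
    proof
      assume "y \<in> M"
      then obtain j where j: "j \<in> {1..r}" "j \<noteq> i" and "a (I j) \<in> M"
        unfolding y_def using M.finprod_memE[of "{1..r} - {i}" "\<lambda>j. a (I j)"] ac by blast
      \<comment> \<open>The argument that gave \<open>I i \<subseteq> M\<close> applies to
        \<open>j\<close> as well; two comaximal ideals would then lie in the proper ideal
        \<open>M\<close>.\<close>
      then have "I j \<subseteq> M"
        using ideal_S_mem_maximalideal[OF M.is_maximalideal M(1) idI aS] j(1) by blast
      then have "I i <+> I j \<subseteq> M"
        using sub M.a_closed unfolding set_add_def' by blast
      moreover have "I i <+> I j = carrier R"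
        using assms(8)[OF i j(1)] j(2) unfolding comaximal_def by blast
      ultimately show False
        using M.I_notcarr M.a_subset by blast
    qed
    moreover have "a (I i) \<otimes> y \<in> I i \<cdot> M"
    proof -
      have "?x = (\<Otimes>j\<in>insert i ({1..r} - {i}). a (I j))"
        using i by (simp add: insert_absorb)
      also have "\<dots> = a (I i) \<otimes> y"
        unfolding y_def using ac i by (intro finprod_insert) auto
      finally have "?x = a (I i) \<otimes> y" .
      \<comment> \<open>This turns membership in \<open>?P \<cdot> M\<close> into membership in
        \<open>I i \<cdot> M\<close>, the ideal that \<open>a (I i)\<close> must avoid.\<close>
      moreover have "?P \<subseteq> I i"
        using i idI by (intro ideals_finprod_subset) auto
      ultimately show ?thesis
        using xM ideal_prod_mono[of ?P "I i" M M R] by auto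
    qed
    ultimately have "a (I i) \<in> I i \<cdot> M"
      using mem_ideal_prod_maximalideal_cancel[OF M.is_maximalideal idI[OF i] aI[OF i] yc]
      by blast
    then show False
      using ideal_S_maximalideal[OF M.is_maximalideal M(1) aS[OF i]] by blast
  qed
  \<comment> \<open>The other half of membership in \<open>ideal_S\<close>: the product of the
    elements lies in the product of the ideals.\<close>
  moreover have "?x \<in> ?P"
    using idI aI by (intro finprod_mem_ideals_finprod) auto
  ultimately show ?thesis
    unfolding ideal_S_def by blast
qed

end
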